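(* Let $n\ge 0$ be a fixed integer. The polynomial sequence $(B_q(n,k))_{0\le k\le n}$ is $q$-log-concave; that is, for all $1\le k\le n-1$ the polynomial $B_q(n,k)^2-B_q(n,k-1)\,B_q(n,k+1)$ in $q$ has only nonnegative coefficients.
   Context: For $0\le k\le n$ the $q$-refined Baxter number is $$B_q(n,k)=q^{\frac{3k(k-1)}{2}}\,\frac{\begin{bmatrix} n\\ k\end{bmatrix}_q\begin{bmatrix} n+1\\ k\end{bmatrix}_q\begin{bmatrix} n+2\\ k\end{bmatrix}_q}{\begin{bmatrix} k+1\\ k\end{bmatrix}_q\begin{bmatrix} k+2\\ k\end{bmatrix}_q},$$ where $[m]_q=\frac{1-q^m}{1-q}$, $[m]_q!=[1]_q[2]_q\cdots[m]_q$ and $\begin{bmatrix} n\\ k\end{bmatrix}_q=\frac{[n]_q!}{[k]_q!\,[n-k]_q!}$. It is a polynomial in $q$. A sequence of real polynomials $(f_k(q))$ is $q$-log-concave if $f_k(q)^2-f_{k-1}(q)f_{k+1}(q)$ has only nonnegative coefficients for every interior index $k$. *)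

theory Defs
  imports Complex_Main "HOL-Computational_Algebra.Computational_Algebra"
begin

(* The quotients below are formed in the field of rational functions R(q), the
   fraction field of real poly, where division is exact and q is an indeterminate. *)

definition qvar :: "real poly fract" where
  "qvar = to_fract [:0, 1:]"

definition qint :: "nat \<Rightarrow> real poly fract" where
  "qint m = (1 - qvar ^ m) / (1 - qvar)"

definition qfact :: "nat \<Rightarrow> real poly fract" where
  "qfact m = (\<Prod>i = 1..m. qint i)"

(* Used only for k <= n: for k > n the truncated subtraction would give a junk value. *)
definition qbinom :: "nat \<Rightarrow> nat \<Rightarrow> real poly fract" where
  "qbinom n k = qfact n / (qfact k * qfact (n - k))"

(* k * (k - 1) is even, and it is 0 for k = 0, so the natural number exponent is
   exactly 3k(k-1)/2. *)
definition qBaxter :: "nat \<Rightarrow> nat \<Rightarrow> real poly fract" where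
  "qBaxter n k =
     qvar ^ (3 * k * (k - 1) div 2) *
     ((qbinom n k * qbinom (n + 1) k * qbinom (n + 2) k) /
      (qbinom (k + 1) k * qbinom (k + 2) k))"

(* q-log-concavity of the finite sequence f 0, ..., f n. *)
definition q_log_concave :: "nat \<Rightarrow> (nat \<Rightarrow> real poly) \<Rightarrow> bool" where
  "q_log_concave n f \<longleftrightarrow>
     (\<forall>k. 1 \<le> k \<and> k \<le> n - 1 \<longrightarrow>
        (\<forall>i. 0 \<le> coeff ((f k)\<^sup>2 - f (k - 1) * f (k + 1)) i))"

end

theory Submission
  imports Defs "Jordan_Normal_Form.Determinant"
begin

text \<open>
  Write $[m]$ for the $q$-integer and let
  $M(a,b,c) = \prod_{i<c} \frac{[a+b+i]!\,[i]!}{[a+i]!\,[b+i]!}$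
  be MacMahon's generating function of the plane partitions in an $a \times b \times c$ box
  (\<open>macmahon_box\<close>). Regrouping factorials gives $B_q(n,k) = q^{3\binom k2} M(k, n-k, 3)$.

  These products satisfy a condensation identity of Dodgson type
  (\<open>macmahon_box_condensation\<close>): for $a, b, c \ge 1$,
  \[ M(a,b,c)^2 - q^c\, M(a-1,b+1,c)\, M(a+1,b-1,c) = M(a,b,c+1)\, M(a,b,c-1). \]
  Dividing by $M(a,b,c)^2$ and clearing denominators turns it into the relation
  $[a+c][b+c] - q^c [a][b] = [a+b+c][c]$. Since
  $\binom{k-1}2 + \binom{k+1}2 = 2\binom k2 + 1$, the powers of $q$ in $B_q(n,k)$ supply exactly
  the factor $q^3$ that the identity with $c = 3$ needs, so that
  \[ B_q(n,k)^2 - B_q(n,k-1)\, B_q(n,k+1) = q^{6\binom k2}\, M(k,n-k,4)\, M(k,n-k,2). \]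

  It remains to see that every $M(a,b,c)$ is a polynomial with nonnegative coefficients. This is
  shown for the larger family $\prod_{i<j<n} [l_j - l_i]/[j-i]$ with $l_0 < l_1 < \dots$
  (\<open>gap_ratio\<close>), which are the principal specializations of Schur polynomials up to a
  power of $q$. The larger family is closed under branching: deleting one variable expresses the
  product for $n+1$ numbers $l_i$ as a sum of products for $n$ numbers $m_i$ interlacing them,
  with powers of $q$ as weights (\<open>gap_ratio_branching\<close>), and induction on $n$ applies.
  The branching rule itself holds because, up to simple factors, the products are Vandermonde
  determinants in the $q^{l_i}$: a determinant can be summed over its rows independently, the
  entries are then geometric sums, and what comes out are differences of consecutive rows of the
  next larger Vandermonde matrix.
\<close>

section \<open>Vandermonde determinants\<close>

lemma det_eq_minor_if_first_column_zero:
  fixes A :: "'a :: comm_ring_1 mat"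
  assumes A: "A \<in> carrier_mat (Suc n) (Suc n)"
    and zero: "\<And>i. i < n \<Longrightarrow> A $$ (Suc i, 0) = 0"
  shows "det A = A $$ (0, 0) * det (mat n n (\<lambda>(i, j). A $$ (Suc i, Suc j)))"
proof -
  have "det A = (\<Sum>i<Suc n. A $$ (i, 0) * cofactor A i 0)"
    using laplace_expansion_column[OF A, of 0] by simp
  also have "\<dots> = A $$ (0, 0) * cofactor A 0 0"
    by (simp only: sum.lessThan_Suc_shift) (simp add: zero)
  also have "mat_delete A 0 0 = mat n n (\<lambda>(i, j). A $$ (Suc i, Suc j))"
    using A by (intro eq_matI) (auto simp: mat_delete_def)
  then have "cofactor A 0 0 = det (mat n n (\<lambda>(i, j). A $$ (Suc i, Suc j)))"
    by (simp add: cofactor_def)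
  finally show ?thesis .
qed

text \<open>The left factor $L$ below is unipotent and performs all row operations at once. The case
  $c = x_0$ reduces Vandermonde matrices to smaller ones, the case $c = 1$ takes differences.\<close>
lemma det_subtract_previous_row:
  fixes f :: "nat \<Rightarrow> nat \<Rightarrow> 'a :: comm_ring_1"
  shows "det (mat n n (\<lambda>(i, j). f i j)) =
    det (mat n n (\<lambda>(i, j). case i of 0 \<Rightarrow> f 0 j | Suc i' \<Rightarrow> f i j - c * f i' j))"
proof -
  define L :: "'a mat" where
    "L = mat n n (\<lambda>(i, k). if i = k then 1 else if i = Suc k then - c else 0)"
  have L: "L \<in> carrier_mat n n" by (simp add: L_def)
  have "det L = prod_list (diag_mat L)"
    by (rule det_lower_triangular[OF _ L]) (auto simp: L_def)
  also have "diag_mat L = replicate n 1"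
    by (rule nth_equalityI) (auto simp: L_def diag_mat_def)
  finally have det_L: "det L = 1" by simp
  have "L * mat n n (\<lambda>(i, j). f i j) =
      mat n n (\<lambda>(i, j). case i of 0 \<Rightarrow> f 0 j | Suc i' \<Rightarrow> f i j - c * f i' j)"
  proof (rule eq_matI)
    fix i j
    assume "i < dim_row (mat n n (\<lambda>(i, j). case i of 0 \<Rightarrow> f 0 j | Suc i' \<Rightarrow> f i j - c * f i' j))"
      and "j < dim_col (mat n n (\<lambda>(i, j). case i of 0 \<Rightarrow> f 0 j | Suc i' \<Rightarrow> f i j - c * f i' j))"
    then have ij: "i < n" "j < n" by auto
    have "(L * mat n n (\<lambda>(i, j). f i j)) $$ (i, j) =
        (\<Sum>k<n. (if i = k then f k j else 0) + (if i = Suc k then - c * f k j else 0))"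
      using ij by (auto simp: L_def scalar_prod_def atLeast0LessThan intro!: sum.cong)
    also have "\<dots> = f i j + (\<Sum>k<n. if i = Suc k then - c * f k j else 0)"
      using ij by (simp add: sum.distrib)
    also have "\<dots> = (case i of 0 \<Rightarrow> f 0 j | Suc i' \<Rightarrow> f i j - c * f i' j)"
      using ij by (cases i) (simp_all)
    finally show "(L * mat n n (\<lambda>(i, j). f i j)) $$ (i, j) =
        mat n n (\<lambda>(i, j). case i of 0 \<Rightarrow> f 0 j | Suc i' \<Rightarrow> f i j - c * f i' j) $$ (i, j)"
      using ij by simp
  qed (simp_all add: L_def)
  moreover have "det (L * mat n n (\<lambda>(i, j). f i j)) = det (mat n n (\<lambda>(i, j). f i j))"
    by (subst det_mult[OF L]) (simp_all add: det_L)
  ultimately show ?thesis by simp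
qed

lemma det_transpose_entries:
  "det (mat n n (\<lambda>(i, j). f i j)) = det (mat n n (\<lambda>(i, j). f j i :: 'a :: comm_ring_1))"
proof -
  have "transpose_mat (mat n n (\<lambda>(i, j). f i j)) = mat n n (\<lambda>(i, j). f j i)"
    by (rule eq_matI) auto
  then show ?thesis
    using det_transpose[of "mat n n (\<lambda>(i, j). f i j)" n] by simp
qed

lemma det_mat_expand:
  "det (mat n n (\<lambda>(i, j). f i j :: 'a :: comm_ring_1)) =
    (\<Sum>p | p permutes {0..<n}. signof p * (\<Prod>i<n. f i (p i)))"
proof -
  have "(\<Prod>i = 0..<n. mat n n (\<lambda>(i, j). f i j) $$ (i, p i)) = (\<Prod>i<n. f i (p i))"
    if p: "p permutes {0..<n}" for p
  proof -
    have "p i < n" if "i < n" for i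
      using permutes_in_image[OF p, of i] that by simp
    then show ?thesis by (simp add: atLeast0LessThan)
  qed
  then show ?thesis
    unfolding det_def'[OF mat_carrier] by (intro sum.cong refl arg_cong2[where f = "(*)"]) auto
qed

lemma det_scale_columns:
  "det (mat n n (\<lambda>(i, j). f i j * c j)) =
    det (mat n n (\<lambda>(i, j). f i j)) * (\<Prod>j<n. c j :: 'a :: comm_ring_1)"
proof -
  have "(\<Prod>i<n. f i (p i) * c (p i)) = (\<Prod>i<n. f i (p i)) * (\<Prod>j<n. c j)"
    if p: "p permutes {0..<n}" for p
    using prod.permute[OF p, of c] by (simp add: prod.distrib comp_def atLeast0LessThan)
  then show ?thesis
    by (simp add: det_mat_expand sum_distrib_right mult.assoc)
qed

text \<open>Multilinearity in the rows, for summation ranges that depend on the row.\<close>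
lemma sum_PiE_det:
  fixes f :: "nat \<Rightarrow> 'b \<Rightarrow> nat \<Rightarrow> 'a :: comm_ring_1"
  assumes "\<And>i. i < n \<Longrightarrow> finite (S i)"
  shows "(\<Sum>m\<in>PiE {..<n} S. det (mat n n (\<lambda>(i, j). f i (m i) j))) =
    det (mat n n (\<lambda>(i, j). \<Sum>s\<in>S i. f i s j))"
proof -
  have "(\<Sum>m\<in>PiE {..<n} S. det (mat n n (\<lambda>(i, j). f i (m i) j))) =
      (\<Sum>p | p permutes {0..<n}. signof p * (\<Sum>m\<in>PiE {..<n} S. \<Prod>i<n. f i (m i) (p i)))"
    unfolding det_mat_expand by (subst sum.swap) (simp add: sum_distrib_left)
  also have "\<dots> = (\<Sum>p | p permutes {0..<n}. signof p * (\<Prod>i<n. \<Sum>s\<in>S i. f i s (p i)))"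
    using assms by (subst prod_sum_PiE) auto
  finally show ?thesis by (simp add: det_mat_expand)
qed

text \<open>In the transposed matrix, subtracting $x_0$ times the previous row clears the first column
  below the diagonal and leaves the factor $x_{j+1} - x_0$ in every column of the minor.\<close>
lemma det_vandermonde:
  fixes x :: "nat \<Rightarrow> 'a :: comm_ring_1"
  shows "det (mat n n (\<lambda>(i, j). x i ^ j)) = (\<Prod>j<n. \<Prod>i<j. x j - x i)"
proof (induction n arbitrary: x)
  case 0
  then show ?case by simp
next
  case (Suc n)
  let ?D = "mat (Suc n) (Suc n) (\<lambda>(i, j). case i of 0 \<Rightarrow> x j ^ 0
      | Suc i' \<Rightarrow> x j ^ i - x 0 * x j ^ i')"
  have "det (mat (Suc n) (Suc n) (\<lambda>(i, j). x i ^ j)) =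
      det (mat (Suc n) (Suc n) (\<lambda>(i, j). x j ^ i))"
    by (rule det_transpose_entries)
  also have "\<dots> = det ?D"
    by (rule det_subtract_previous_row)
  also have "\<dots> = det (mat n n (\<lambda>(i, j). x (Suc j) ^ i * (x (Suc j) - x 0)))"
    by (subst det_eq_minor_if_first_column_zero[of _ n])
       (auto intro!: arg_cong[of _ _ det] eq_matI simp: algebra_simps)
  also have "\<dots> = det (mat n n (\<lambda>(i, j). x (Suc i) ^ j)) * (\<Prod>j<n. x (Suc j) - x 0)"
    by (simp only: det_scale_columns det_transpose_entries[of n "\<lambda>i j. x (Suc j) ^ i"])
  also have "\<dots> = (\<Prod>j<Suc n. \<Prod>i<j. x j - x i)"
    by (simp only: prod.lessThan_Suc_shift Suc.IH prod.distrib) (simp add: mult.commute)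
  finally show ?case .
qed

text \<open>The differences are what subtracting consecutive rows of the Vandermonde matrix of size
  $n+1$ leaves; its constant first column becomes $(1, 0, \dots, 0)$ and drops out.\<close>
lemma det_power_differences:
  fixes x :: "nat \<Rightarrow> 'a :: comm_ring_1"
  shows "det (mat n n (\<lambda>(i, j). x (Suc i) ^ Suc j - x i ^ Suc j)) =
    (\<Prod>j<Suc n. \<Prod>i<j. x j - x i)"
proof -
  have "(\<Prod>j<Suc n. \<Prod>i<j. x j - x i) = det (mat (Suc n) (Suc n) (\<lambda>(i, j). x i ^ j))"
    by (rule det_vandermonde[symmetric])
  also have "\<dots> = det (mat (Suc n) (Suc n) (\<lambda>(i, j). case i of 0 \<Rightarrow> x 0 ^ j
      | Suc i' \<Rightarrow> x i ^ j - 1 * x i' ^ j))"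
    by (rule det_subtract_previous_row)
  also have "\<dots> = det (mat n n (\<lambda>(i, j). x (Suc i) ^ Suc j - x i ^ Suc j))"
    by (subst det_eq_minor_if_first_column_zero[of _ n])
       (auto intro!: arg_cong[of _ _ det] eq_matI)
  finally show ?thesis by simp
qed

lemma sum_power_interval:
  fixes z :: "'a :: field"
  assumes "z \<noteq> 1" "a \<le> b"
  shows "(\<Sum>s\<in>{a..<b}. z ^ s) = (z ^ b - z ^ a) * inverse (z - 1)"
proof -
  have "(\<Sum>s\<in>{a..<b}. z ^ s) * (z - 1) = z ^ b - z ^ a"
    using assms(2) by (induction rule: dec_induct) (auto simp: algebra_simps)
  then show ?thesis using assms(1) by (simp add: field_simps)
qed

text \<open>The factor $\prod_i q^{m_i}$ raises the exponents in the Vandermonde matrix of the $q^{m_i}$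
  from $j$ to $j+1$, which removes the constant column. Each entry therefore sums to a genuine
  geometric sum, whose numerator is a difference of powers of $q^{l_{i+1}}$ and $q^{l_i}$ and whose
  denominator depends only on the column.\<close>
lemma sum_interlacing_vandermonde:
  fixes q :: "'a :: field"
  assumes q: "\<And>k. k > 0 \<Longrightarrow> q ^ k \<noteq> 1"
    and l: "\<And>i. i < n \<Longrightarrow> l i \<le> l (Suc i)"
  shows "(\<Sum>m\<in>PiE {..<n} (\<lambda>i. {l i..<l (Suc i)}).
      (\<Prod>i<n. q ^ m i) * (\<Prod>j<n. \<Prod>i<j. q ^ m j - q ^ m i)) =
    (\<Prod>j<Suc n. \<Prod>i<j. q ^ l j - q ^ l i) * (\<Prod>j<n. inverse (q ^ Suc j - 1))"
proof -
  let ?S = "\<lambda>i. {l i..<l (Suc i)}"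
  have summand: "(\<Prod>i<n. q ^ m i) * (\<Prod>j<n. \<Prod>i<j. q ^ m j - q ^ m i) =
      det (mat n n (\<lambda>(i, j). (q ^ Suc j) ^ m i))" for m
  proof -
    have "(\<Prod>i<n. q ^ m i) * (\<Prod>j<n. \<Prod>i<j. q ^ m j - q ^ m i) =
        det (mat n n (\<lambda>(i, j). (q ^ m j) ^ i * q ^ m j))"
      by (simp only: det_scale_columns det_transpose_entries[of n "\<lambda>i j. (q ^ m j) ^ i"]
            det_vandermonde) (rule mult.commute)
    also have "\<dots> = det (mat n n (\<lambda>(i, j). (q ^ m i) ^ j * q ^ m i))"
      by (rule det_transpose_entries)
    also have "\<dots> = det (mat n n (\<lambda>(i, j). (q ^ Suc j) ^ m i))"
      by (simp add: power_mult_distrib power_mult[symmetric] power_add[symmetric] ac_simps)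
    finally show ?thesis .
  qed
  have "(\<Sum>m\<in>PiE {..<n} ?S. (\<Prod>i<n. q ^ m i) * (\<Prod>j<n. \<Prod>i<j. q ^ m j - q ^ m i)) =
      det (mat n n (\<lambda>(i, j). \<Sum>s\<in>?S i. (q ^ Suc j) ^ s))"
    by (simp only: summand sum_PiE_det[of n ?S "\<lambda>i s j. (q ^ Suc j) ^ s"] finite_atLeastLessThan)
  also have "mat n n (\<lambda>(i, j). \<Sum>s\<in>?S i. (q ^ Suc j) ^ s) =
      mat n n (\<lambda>(i, j). ((q ^ l (Suc i)) ^ Suc j - (q ^ l i) ^ Suc j) * inverse (q ^ Suc j - 1))"
  proof (rule cong_mat)
    fix i j assume "i < n" "j < n"
    then show "(case (i, j) of (i, j) \<Rightarrow> \<Sum>s\<in>?S i. (q ^ Suc j) ^ s) =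
      (case (i, j) of (i, j) \<Rightarrow>
        ((q ^ l (Suc i)) ^ Suc j - (q ^ l i) ^ Suc j) * inverse (q ^ Suc j - 1))"
      using sum_power_interval[OF q[of "Suc j"] l[of i]]
      by (simp only: prod.case power_mult[symmetric] mult.commute[of "Suc j"] zero_less_Suc)
  qed simp_all
  also have "det \<dots> =
      (\<Prod>j<Suc n. \<Prod>i<j. q ^ l j - q ^ l i) * (\<Prod>j<n. inverse (q ^ Suc j - 1))"
    by (simp only: det_scale_columns det_power_differences[of n "\<lambda>i. q ^ l i"])
  finally show ?thesis .
qed

section \<open>Polynomials with nonnegative coefficients among the rational functions\<close>

definition nonneg_poly :: "real poly fract \<Rightarrow> bool" where
  "nonneg_poly x \<longleftrightarrow> (\<exists>p. x = to_fract p \<and> (\<forall>i. 0 \<le> coeff p i))"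

lemma nonneg_poly_1: "nonneg_poly 1"
  unfolding nonneg_poly_def by (rule exI[of _ 1]) (auto simp: coeff_1)

lemma nonneg_poly_qvar: "nonneg_poly qvar"
  unfolding nonneg_poly_def qvar_def
  by (rule exI[of _ "[:0, 1:]"]) (auto simp: coeff_pCons split: nat.split)

lemma nonneg_poly_mult:
  assumes "nonneg_poly x" "nonneg_poly y"
  shows "nonneg_poly (x * y)"
proof -
  obtain p r where "x = to_fract p" "y = to_fract r" "\<forall>i. 0 \<le> coeff p i" "\<forall>i. 0 \<le> coeff r i"
    using assms unfolding nonneg_poly_def by blast
  then show ?thesis
    unfolding nonneg_poly_def
    by (intro exI[of _ "p * r"]) (auto simp: coeff_mult intro!: sum_nonneg)
qed

lemma nonneg_poly_power: "nonneg_poly x \<Longrightarrow> nonneg_poly (x ^ k)"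
  by (induction k) (auto intro: nonneg_poly_1 nonneg_poly_mult)

lemma nonneg_poly_prod: "(\<And>i. i \<in> A \<Longrightarrow> nonneg_poly (f i)) \<Longrightarrow> nonneg_poly (\<Prod>i\<in>A. f i)"
  by (induction A rule: infinite_finite_induct) (auto intro: nonneg_poly_1 nonneg_poly_mult)

lemma nonneg_poly_sum:
  assumes "\<And>i. i \<in> A \<Longrightarrow> nonneg_poly (f i)"
  shows "nonneg_poly (\<Sum>i\<in>A. f i)"
proof -
  obtain p where p: "\<And>i. i \<in> A \<Longrightarrow> f i = to_fract (p i)"
      "\<And>i k. i \<in> A \<Longrightarrow> 0 \<le> coeff (p i) k"
    using assms unfolding nonneg_poly_def by metis
  then show ?thesis
    unfolding nonneg_poly_def
    by (intro exI[of _ "\<Sum>i\<in>A. p i"]) (auto simp: coeff_sum intro!: sum_nonneg)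
qed

section \<open>Quotients of differences of $q$-integers\<close>

lemma qvar_power_neq_1: "k > 0 \<Longrightarrow> qvar ^ k \<noteq> 1"
proof
  assume k: "k > 0" and "qvar ^ k = 1"
  have "qvar ^ m = to_fract ([:0, 1:] ^ m)" for m
    by (induction m) (simp_all only: power_0 power_Suc to_fract_mult to_fract_1 qvar_def)
  with \<open>qvar ^ k = 1\<close> have "to_fract ([:0, 1:] ^ k) = to_fract (1 :: real poly)" by simp
  then have "[:0, 1:] ^ k = (1 :: real poly)" by (simp only: to_fract_eq_iff)
  then have "poly ([:0, 1:] ^ k) 0 = (1 :: real)" by simp
  with k show False by (simp add: poly_power power_0_left)
qed

lemma qvar_neq_0: "qvar \<noteq> 0"
  by (simp add: qvar_def)

lemma qvar_neq_1: "qvar \<noteq> 1"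
  using qvar_power_neq_1[of 1] by simp

lemma qint_eq_0_iff: "qint m = 0 \<longleftrightarrow> m = 0"
  using qvar_power_neq_1[of m] qvar_neq_1 by (cases "m = 0") (auto simp: qint_def)

lemma qfact_0: "qfact 0 = 1"
  by (simp add: qfact_def)

lemma qfact_Suc: "qfact (Suc m) = qfact m * qint (Suc m)"
  by (simp add: qfact_def)

lemma qfact_neq_0: "qfact m \<noteq> 0"
  by (induction m) (simp_all add: qfact_0 qfact_Suc qint_eq_0_iff)

text \<open>For $l_0 < \dots < l_{n-1}$ this is $s_\lambda(1, q, \dots, q^{n-1})$ divided by its lowest
  power of $q$, where $\lambda$ has the parts $l_j - j$. With that power left out, the weights in the
  branching rule are powers of $q$ with nonnegative exponents.\<close>
definition gap_ratio :: "nat \<Rightarrow> (nat \<Rightarrow> nat) \<Rightarrow> real poly fract" where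
  "gap_ratio n l = (\<Prod>j<n. \<Prod>i<j. qint (l j - l i) / qint (j - i))"

lemma gap_ratio_Suc:
  "gap_ratio (Suc n) l = gap_ratio n l * (\<Prod>i<n. qint (l n - l i) / qint (n - i))"
  by (simp add: gap_ratio_def)

lemma vandermonde_gap_ratio:
  assumes "\<And>i j. i < j \<Longrightarrow> j < n \<Longrightarrow> l i \<le> l j"
  shows "(\<Prod>j<n. \<Prod>i<j. qvar ^ l j - qvar ^ l i) =
    gap_ratio n l * (\<Prod>j<n. \<Prod>i<j. qvar ^ l i) * (\<Prod>j<n. \<Prod>i<j. qvar ^ (j - i) - 1)"
proof -
  have "qvar ^ l j - qvar ^ l i =
      qint (l j - l i) / qint (j - i) * qvar ^ l i * (qvar ^ (j - i) - 1)"
    if "i < j" "j < n" for i j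
  proof -
    have "qvar ^ l j = qvar ^ l i * qvar ^ (l j - l i)"
      using assms[OF that] by (simp add: power_add[symmetric])
    moreover have "1 - qvar ^ (j - i) \<noteq> 0"
      using qvar_power_neq_1[of "j - i"] that by simp
    ultimately show ?thesis
      using qvar_neq_1 by (simp add: qint_def divide_simps) (simp add: algebra_simps)
  qed
  then show ?thesis
    by (simp add: gap_ratio_def prod.distrib[symmetric])
qed

lemma interlacing_strict_mono:
  fixes l m :: "nat \<Rightarrow> nat"
  assumes l: "\<And>i j. i < j \<Longrightarrow> j \<le> n \<Longrightarrow> l i < l j"
    and m: "m \<in> PiE {..<n} (\<lambda>i. {l i..<l (Suc i)})"
    and ij: "i < j" "j < n"
  shows "m i < m j"
proof -
  have "m i < l (Suc i)" using m ij by (auto simp: PiE_iff)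
  also have "l (Suc i) \<le> l j"
    using l[of "Suc i" j] ij by (cases "Suc i = j") auto
  also have "\<dots> \<le> m j" using m ij by (auto simp: PiE_iff)
  finally show ?thesis .
qed

text \<open>The branching rule of Schur polynomials under deletion of a variable: the $m_i$ encode the
  partitions that interlace with the one encoded by $l$. Writing both sides as Vandermonde products
  reduces it to \<open>sum_interlacing_vandermonde\<close>.\<close>
lemma gap_ratio_branching:
  assumes l: "\<And>i j. i < j \<Longrightarrow> j \<le> n \<Longrightarrow> l i < l j"
  shows "gap_ratio (Suc n) l = (\<Sum>m\<in>PiE {..<n} (\<lambda>i. {l i..<l (Suc i)}).
    (\<Prod>j<Suc n. \<Prod>i<j. qvar ^ (m i - l i)) * gap_ratio n m)"
proof -
  let ?M = "PiE {..<n} (\<lambda>i. {l i..<l (Suc i)})"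
  let ?L = "\<Prod>j<Suc n. \<Prod>i<j. qvar ^ l i"
  let ?V = "\<Prod>j<n. \<Prod>i<j. qvar ^ (j - i) - 1"
  let ?W = "\<Prod>j<n. qvar ^ Suc j - 1"
  \<comment> \<open>The normalizing denominators for $n+1$ and for $n$ differ exactly by the denominators of the
    geometric sums.\<close>
  have "(\<Prod>i<n. qvar ^ (n - i) - 1) = ?W"
    using prod.nat_diff_reindex[of "\<lambda>i. qvar ^ Suc i - 1" n]
    by (simp add: Suc_diff_Suc del: power_Suc cong: prod.cong_simp)
  then have V: "(\<Prod>j<Suc n. \<Prod>i<j. qvar ^ (j - i) - 1) = ?V * ?W"
    by simp
  have neq: "?L \<noteq> 0" "?V \<noteq> 0" "?W \<noteq> 0"
    using qvar_neq_0 qvar_power_neq_1 by (auto simp del: power_Suc)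
  have summand: "(\<Prod>i<n. qvar ^ m i) * (\<Prod>j<n. \<Prod>i<j. qvar ^ m j - qvar ^ m i) =
      ?L * ?V * ((\<Prod>j<Suc n. \<Prod>i<j. qvar ^ (m i - l i)) * gap_ratio n m)" if m: "m \<in> ?M" for m
  proof -
    have m_bounds: "l i \<le> m i" "m i < l (Suc i)" if "i < n" for i
      using m that by (auto simp: PiE_iff)
    have "m i \<le> m j" if "i < j" "j < n" for i j
      using interlacing_strict_mono[OF l m that] by simp
    then have "(\<Prod>i<n. qvar ^ m i) * (\<Prod>j<n. \<Prod>i<j. qvar ^ m j - qvar ^ m i) =
        (\<Prod>j<Suc n. \<Prod>i<j. qvar ^ m i) * ?V * gap_ratio n m"
      by (subst vandermonde_gap_ratio) auto
    \<comment> \<open>The powers of $q$ factored out of both Vandermonde products have the same shape, since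
      $\prod_i q^{m_i}$ supplies the factors for $j = n$; their quotient is the weight.\<close>
    also have "(\<Prod>j<Suc n. \<Prod>i<j. qvar ^ m i) =
        (\<Prod>j<Suc n. \<Prod>i<j. qvar ^ l i * qvar ^ (m i - l i))"
      using m_bounds by (intro prod.cong) (auto simp: power_add[symmetric])
    also have "\<dots> = ?L * (\<Prod>j<Suc n. \<Prod>i<j. qvar ^ (m i - l i))"
      by (simp only: prod.distrib)
    finally show ?thesis by (simp only: ac_simps)
  qed
  have "gap_ratio (Suc n) l * ?L * (?V * ?W) = (\<Prod>j<Suc n. \<Prod>i<j. qvar ^ l j - qvar ^ l i)"
    unfolding V[symmetric]
    by (rule vandermonde_gap_ratio[symmetric], rule less_imp_le, rule l) auto
  also have "\<dots> = (\<Prod>j<Suc n. \<Prod>i<j. qvar ^ l j - qvar ^ l i) *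
      ((\<Prod>j<n. inverse (qvar ^ Suc j - 1)) * ?W)"
    by (simp add: prod.distrib[symmetric] qvar_power_neq_1 del: power_Suc prod.lessThan_Suc)
  also have "\<dots> = (\<Sum>m\<in>?M. (\<Prod>i<n. qvar ^ m i) * (\<Prod>j<n. \<Prod>i<j. qvar ^ m j - qvar ^ m i)) * ?W"
    unfolding mult.assoc[symmetric]
    by (subst sum_interlacing_vandermonde[OF qvar_power_neq_1 less_imp_le[OF l]]) simp_all
  also have "\<dots> = (\<Sum>m\<in>?M. ?L * ?V *
      ((\<Prod>j<Suc n. \<Prod>i<j. qvar ^ (m i - l i)) * gap_ratio n m)) * ?W"
    by (simp only: summand cong: sum.cong)
  also have "\<dots> = (\<Sum>m\<in>?M. (\<Prod>j<Suc n. \<Prod>i<j. qvar ^ (m i - l i)) * gap_ratio n m) * ?L * (?V * ?W)"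
    unfolding sum_distrib_left[symmetric] by (simp only: ac_simps)
  finally show ?thesis
    unfolding mult.assoc by (simp only: mult_cancel_right mult_eq_0_iff neq simp_thms)
qed

theorem nonneg_poly_gap_ratio:
  assumes "\<And>i j. i < j \<Longrightarrow> j < n \<Longrightarrow> l i < l j"
  shows "nonneg_poly (gap_ratio n l)"
  using assms
proof (induction n arbitrary: l)
  case 0
  show ?case by (simp add: gap_ratio_def nonneg_poly_1)
next
  case (Suc n)
  let ?M = "PiE {..<n} (\<lambda>i. {l i..<l (Suc i)})"
  have "nonneg_poly (gap_ratio n m)" if m: "m \<in> ?M" for m
    using interlacing_strict_mono[OF _ m] Suc.prems by (intro Suc.IH) auto
  moreover have "gap_ratio (Suc n) l =
      (\<Sum>m\<in>?M. (\<Prod>j<Suc n. \<Prod>i<j. qvar ^ (m i - l i)) * gap_ratio n m)"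
    using Suc.prems by (intro gap_ratio_branching) auto
  ultimately show ?case
    by (auto intro!: nonneg_poly_sum nonneg_poly_mult nonneg_poly_prod nonneg_poly_power
        nonneg_poly_qvar)
qed

section \<open>MacMahon's box formula\<close>

definition macmahon_box :: "nat \<Rightarrow> nat \<Rightarrow> nat \<Rightarrow> real poly fract" where
  "macmahon_box a b c =
    (\<Prod>i<c. qfact (a + b + i) * qfact i / (qfact (a + i) * qfact (b + i)))"

lemma macmahon_box_Suc:
  "macmahon_box a b (Suc c) =
    macmahon_box a b c * (qfact (a + b + c) * qfact c / (qfact (a + c) * qfact (b + c)))"
  by (simp add: macmahon_box_def)

lemma prod_qint_descending: "(\<Prod>i<b. qint (b + m - i)) = qfact (b + m) / qfact m"
proof (induction b)
  case 0
  show ?case by (simp add: qfact_neq_0)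
next
  case (Suc b)
  then show ?case
    by (simp only: prod.lessThan_Suc_shift) (simp add: qfact_Suc mult.commute)
qed

text \<open>The rectangular partition with $c$ parts $a$ and $b$ parts $0$. Two indices on the same side
  of $b$ contribute $1$; the index $b + c$ paired with all $i < b$ contributes one factor of
  MacMahon's product.\<close>
lemma macmahon_box_eq_gap_ratio:
  "macmahon_box a b c = gap_ratio (b + c) (\<lambda>j. if j < b then j else j + a)" (is "_ = gap_ratio _ ?l")
proof (induction c)
  case 0
  have "gap_ratio b ?l = (\<Prod>j<b. \<Prod>i<j. 1)"
    unfolding gap_ratio_def by (intro prod.cong) (auto simp: qint_eq_0_iff)
  then show ?case by (simp add: macmahon_box_def)
next
  case (Suc c)
  have "(\<Prod>i<b + c. qint (?l (b + c) - ?l i) / qint (b + c - i)) =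
      (\<Prod>i<b. qint (?l (b + c) - ?l i) / qint (b + c - i))"
    by (rule prod.mono_neutral_right) (auto simp: qint_eq_0_iff)
  also have "\<dots> = (\<Prod>i<b. qint (b + (a + c) - i)) / (\<Prod>i<b. qint (b + c - i))"
    by (simp add: prod_dividef[symmetric] ac_simps)
  also have "\<dots> = qfact (a + b + c) * qfact c / (qfact (a + c) * qfact (b + c))"
    by (simp only: prod_qint_descending) (simp add: ac_simps)
  finally show ?case
    by (simp only: macmahon_box_Suc Suc.IH add_Suc_right gap_ratio_Suc)
qed

corollary nonneg_poly_macmahon_box: "nonneg_poly (macmahon_box a b c)"
  unfolding macmahon_box_eq_gap_ratio by (rule nonneg_poly_gap_ratio) auto

text \<open>Dividing the product of the two neighbours by the square of the middle term leaves the
  factors $[a+1+i]\,[b+1+i] / ([a+2+i]\,[b+2+i])$ with $i < c$, whose product telescopes.\<close>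
lemma macmahon_box_neighbours:
  "macmahon_box a (Suc (Suc b)) c * macmahon_box (Suc (Suc a)) b c * (qint (Suc a + c) * qint (Suc b + c)) =
    (macmahon_box (Suc a) (Suc b) c)\<^sup>2 * (qint (Suc a) * qint (Suc b))"
proof (induction c)
  case 0
  show ?case by (simp add: macmahon_box_def)
next
  case (Suc c)
  define r where "r a b = qfact (a + b + c) * qfact c / (qfact (a + c) * qfact (b + c))" for a b
  have box_Suc: "macmahon_box a b (Suc c) = macmahon_box a b c * r a b" for a b
    by (simp only: macmahon_box_Suc r_def)
  have ratio: "r a (Suc (Suc b)) * r (Suc (Suc a)) b * (qint (Suc a + Suc c) * qint (Suc b + Suc c)) =
      (r (Suc a) (Suc b))\<^sup>2 * (qint (Suc a + c) * qint (Suc b + c))"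
    by (simp add: r_def qfact_Suc qfact_neq_0 qint_eq_0_iff power2_eq_square divide_simps)
  have "macmahon_box a (Suc (Suc b)) (Suc c) * macmahon_box (Suc (Suc a)) b (Suc c) *
        (qint (Suc a + Suc c) * qint (Suc b + Suc c)) =
      (macmahon_box a (Suc (Suc b)) c * macmahon_box (Suc (Suc a)) b c) *
        (r a (Suc (Suc b)) * r (Suc (Suc a)) b * (qint (Suc a + Suc c) * qint (Suc b + Suc c)))"
    by (simp only: box_Suc ac_simps)
  also have "\<dots> = (r (Suc a) (Suc b))\<^sup>2 * (macmahon_box a (Suc (Suc b)) c * macmahon_box (Suc (Suc a)) b c *
        (qint (Suc a + c) * qint (Suc b + c)))"
    unfolding ratio by (simp only: ac_simps)
  also have "\<dots> = (macmahon_box (Suc a) (Suc b) (Suc c))\<^sup>2 * (qint (Suc a) * qint (Suc b))"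
    unfolding Suc.IH box_Suc power_mult_distrib by (simp only: ac_simps)
  finally show ?case .
qed

lemma qint_condensation:
  "qint (a + c) * qint (b + c) - qvar ^ c * (qint a * qint b) = qint (a + b + c) * qint c"
  unfolding qint_def times_divide_times_eq
  unfolding times_divide_eq_right diff_divide_distrib[symmetric]
  by (rule arg_cong2[where f = "(/)"]) (simp_all add: algebra_simps power_add)

text \<open>The right-hand side and the product subtracted on the left are multiples of
  $M(a+1,b+1,c+1)^2$ by simple quotients of $q$-integers with the common denominator $D$; what is left
  is \<open>qint_condensation\<close>.\<close>
lemma macmahon_box_condensation:
  "(macmahon_box (Suc a) (Suc b) (Suc c))\<^sup>2 -
      qvar ^ Suc c * (macmahon_box a (Suc (Suc b)) (Suc c) * macmahon_box (Suc (Suc a)) b (Suc c)) =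
    macmahon_box (Suc a) (Suc b) (Suc (Suc c)) * macmahon_box (Suc a) (Suc b) c"
  (is "?M\<^sup>2 - qvar ^ Suc c * ?N = ?P * ?Q")
proof -
  let ?D = "qint (Suc a + Suc c) * qint (Suc b + Suc c)"
  have D: "?D \<noteq> 0" by (simp add: qint_eq_0_iff)
  have PQ: "?P * ?Q * ?D = ?M\<^sup>2 * (qint (Suc a + Suc b + Suc c) * qint (Suc c))"
    by (simp add: macmahon_box_Suc qfact_Suc qfact_neq_0 qint_eq_0_iff power2_eq_square divide_simps)
  have "(?M\<^sup>2 - qvar ^ Suc c * ?N) * ?D = ?M\<^sup>2 * ?D - qvar ^ Suc c * (?N * ?D)"
    by (simp only: left_diff_distrib mult.assoc)
  also have "\<dots> = ?M\<^sup>2 * (?D - qvar ^ Suc c * (qint (Suc a) * qint (Suc b)))"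
    unfolding macmahon_box_neighbours right_diff_distrib by (simp only: ac_simps)
  also have "\<dots> = ?P * ?Q * ?D"
    by (simp only: qint_condensation PQ)
  finally show ?thesis using D by (simp only: mult_cancel_right) simp
qed

section \<open>Log-concavity of the $q$-Baxter numbers\<close>

text \<open>The two denominators $[k+1]$ and $\binom{k+2}{k}_q$ turn the factorials
  $[k]!^3$ of the numerator into $[k]!\,[k+1]!\,[k+2]!$, up to $[2]!$.\<close>
lemma qBaxter_eq_macmahon_box:
  assumes "k \<le> n"
  shows "qBaxter n k = qvar ^ (3 * (k choose 2)) * macmahon_box k (n - k) 3"
proof -
  obtain b where n: "n = k + b" using assms le_Suc_ex by blast
  have "macmahon_box k b 3 = qfact (k + b) / (qfact k * qfact b) *
      (qfact (Suc (k + b)) / (qfact (Suc k) * qfact (Suc b))) *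
      (qfact (Suc (Suc (k + b))) * qfact (Suc (Suc 0)) / (qfact (Suc (Suc k)) * qfact (Suc (Suc b))))"
    by (simp add: macmahon_box_def numeral_3_eq_3 qfact_0 qfact_Suc qint_def qvar_neq_1)
  also have "\<dots> = (qbinom n k * qbinom (n + 1) k * qbinom (n + 2) k) /
      (qbinom (k + 1) k * qbinom (k + 2) k)"
    by (simp add: qbinom_def n Suc_diff_le qfact_neq_0 divide_simps)
       (simp add: qfact_0 qfact_Suc qint_def qvar_neq_1)
  finally have "qBaxter n k = qvar ^ (3 * k * (k - 1) div 2) * macmahon_box k b 3"
    by (simp only: qBaxter_def)
  moreover have "3 * k * (k - 1) div 2 = 3 * (k choose 2)"
  proof -
    have "even (k * (k - 1))" by (cases k) auto
    then show ?thesis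
      using div_mult_swap[of 2 "k * (k - 1)" 3] by (simp only: choose_two mult.assoc)
  qed
  ultimately show ?thesis by (simp add: n)
qed

theorem theorem6p3:
  fixes n :: nat
  shows "\<exists>B :: nat \<Rightarrow> real poly.
           (\<forall>k\<le>n. to_fract (B k) = qBaxter n k) \<and> q_log_concave n B"
proof -
  have "nonneg_poly (qBaxter n k)" if "k \<le> n" for k
    using that by (simp add: qBaxter_eq_macmahon_box nonneg_poly_mult nonneg_poly_power
        nonneg_poly_qvar nonneg_poly_macmahon_box)
  then obtain B where B: "\<forall>k\<le>n. to_fract (B k) = qBaxter n k"
    unfolding nonneg_poly_def by metis
  have "0 \<le> coeff ((B k)\<^sup>2 - B (k - 1) * B (k + 1)) i" if k: "1 \<le> k" "k \<le> n - 1" for k i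
  proof -
    obtain a where a: "k = Suc a" using k by (cases k) auto
    define b where "b = n - Suc k"
    then have n: "n = k + Suc b" using k by simp
    \<comment> \<open>The surplus $3$ is the power of $q$ in the condensation identity for $c = 3$.\<close>
    have "3 * (a choose 2) + 3 * (Suc (Suc a) choose 2) =
        3 * (Suc a choose 2) + 3 * (Suc a choose 2) + 3"
      by (simp add: numeral_2_eq_2)
    then have powers: "qvar ^ (3 * (a choose 2)) * qvar ^ (3 * (Suc (Suc a) choose 2)) =
        (qvar ^ (3 * (Suc a choose 2)))\<^sup>2 * qvar ^ 3"
      by (simp only: power2_eq_square power_add[symmetric])
    have "to_fract ((B k)\<^sup>2 - B (k - 1) * B (k + 1)) =
        qBaxter n k * qBaxter n k - qBaxter n a * qBaxter n (Suc (Suc a))"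
      using B n a by (simp add: power2_eq_square)
    also have "\<dots> = (qvar ^ (3 * (Suc a choose 2)) * macmahon_box (Suc a) (Suc b) 3)\<^sup>2 -
        (qvar ^ (3 * (a choose 2)) * qvar ^ (3 * (Suc (Suc a) choose 2))) *
        (macmahon_box a (Suc (Suc b)) 3 * macmahon_box (Suc (Suc a)) b 3)"
      by (simp add: qBaxter_eq_macmahon_box n a power2_eq_square Suc_diff_le)
    also have "\<dots> = (qvar ^ (3 * (Suc a choose 2)))\<^sup>2 * ((macmahon_box (Suc a) (Suc b) 3)\<^sup>2 -
        qvar ^ 3 * (macmahon_box a (Suc (Suc b)) 3 * macmahon_box (Suc (Suc a)) b 3))"
      unfolding powers by (simp only: power_mult_distrib right_diff_distrib mult.assoc)
    also have "\<dots> = (qvar ^ (3 * (Suc a choose 2)))\<^sup>2 *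
        (macmahon_box (Suc a) (Suc b) 4 * macmahon_box (Suc a) (Suc b) 2)"
      using macmahon_box_condensation[of a b 2] by (simp add: eval_nat_numeral)
    finally have "nonneg_poly (to_fract ((B k)\<^sup>2 - B (k - 1) * B (k + 1)))"
      by (simp add: nonneg_poly_mult nonneg_poly_power nonneg_poly_qvar nonneg_poly_macmahon_box)
    then show ?thesis unfolding nonneg_poly_def by (metis to_fract_eq_iff)
  qed
  with B show ?thesis unfolding q_log_concave_def by blast
qed

end
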